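(* Let $n\geq 1$. If a simplicial complex $K$ on $I_n$ generates $\mathsf{Mon}_n$, then $K$ contains, as a simplex, an interval of size $\left\lfloor\frac{3n+1}{4}\right\rfloor$.
   Context: For finite sets $A,I$, a language is a subset $L\subseteq A^I$. For finite sets $B,J$ and a function $f:B^J\to A^I$, the input window $\mathcal{W}_f(i)\subseteq J$ of $i\in I$ is the smallest $W\subseteq J$ such that for all $x,y\in B^J$ agreeing on $W$, $f(x)_i=f(y)_i$. The communication complex $K_f$ is the simplicial complex on vertex set $I$ whose simplices are the sets $S\subseteq I$ with $\bigcap_{i\in S}\mathcal{W}_f(i)\neq\emptyset$. A simplicial complex $K$ on $I$ generates $L$ if there exist finite sets $B,J$ and $f:B^J\to A^I$ with $f(B^J)=L$ and $K_f\subseteq K$. $\mathsf{Mon}_n\subseteq\{0,1\}^n$ is the set of binary strings $x_0\ldots x_{n-1}$ that are non-decreasing or non-increasing. Positions $I_n=\{0,\ldots,n-1\}$ are identified with $\mathbb{Z}/n\mathbb{Z}$. For $a,b\in\mathbb{Z}$, the interval $[\![a,b]\!]=\{c\bmod n: c\in\mathbb{Z},\ a\leq c\leq b'\}$ where $b'$ is the representative of $b$ modulo $n$ with $a\leq b'<a+n$; its size is $1+((b-a)\bmod n)$. *)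

theory Defs
  imports Complex_Main "HOL-Library.FuncSet"
begin

text \<open>
  \<open>A\<^sup>I\<close> is the set \<open>I \<rightarrow>\<^sub>E A\<close> of extensional functions.
\<close>

definition determines ::
  "'b set \<Rightarrow> 'j set \<Rightarrow> (('j \<Rightarrow> 'b) \<Rightarrow> 'i \<Rightarrow> 'a) \<Rightarrow> 'i \<Rightarrow> 'j set \<Rightarrow> bool" where
  "determines B J f i W \<longleftrightarrow>
     W \<subseteq> J \<and>
     (\<forall>x \<in> J \<rightarrow>\<^sub>E B. \<forall>y \<in> J \<rightarrow>\<^sub>E B. (\<forall>j\<in>W. x j = y j) \<longrightarrow> f x i = f y i)"

text \<open>
  On sets the order is inclusion, so \<^term>\<open>Least\<close> denotes the smallest such set; it exists
  for finite \<open>J\<close> by \<open>determines_input_window\<close> below.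
\<close>

definition input_window ::
  "'b set \<Rightarrow> 'j set \<Rightarrow> (('j \<Rightarrow> 'b) \<Rightarrow> 'i \<Rightarrow> 'a) \<Rightarrow> 'i \<Rightarrow> 'j set" where
  "input_window B J f i = (LEAST W. determines B J f i W)"

text \<open>
  Complexes are downward closed and may contain the empty simplex. The intersection over
  \<open>S = {}\<close> is \<^term>\<open>UNIV\<close>, so the empty simplex always belongs to the communication complex.
  A vertex need not be a simplex: a constant output position has an empty input window.
\<close>

definition simplicial_complex :: "'i set \<Rightarrow> 'i set set \<Rightarrow> bool" where
  "simplicial_complex I K \<longleftrightarrow> (\<forall>S\<in>K. S \<subseteq> I) \<and> (\<forall>S\<in>K. \<forall>T. T \<subseteq> S \<longrightarrow> T \<in> K)"

definition communication_complex ::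
  "'b set \<Rightarrow> 'j set \<Rightarrow> 'i set \<Rightarrow> (('j \<Rightarrow> 'b) \<Rightarrow> 'i \<Rightarrow> 'a) \<Rightarrow> 'i set set" where
  "communication_complex B J I f = {S. S \<subseteq> I \<and> (\<Inter>i\<in>S. input_window B J f i) \<noteq> {}}"

text \<open>
  The existential quantifier over finite sets \<open>B\<close>, \<open>J\<close> ranges over finite sets of natural
  numbers, since a formula cannot quantify over types. By \<open>generatesI\<close> below this is no
  restriction.
\<close>

definition generates :: "'a set \<Rightarrow> 'i set \<Rightarrow> 'i set set \<Rightarrow> ('i \<Rightarrow> 'a) set \<Rightarrow> bool" where
  "generates A I K L \<longleftrightarrow>
     (\<exists>(B::nat set) (J::nat set) f.
        finite B \<and> finite J \<and> f \<in> (J \<rightarrow>\<^sub>E B) \<rightarrow> (I \<rightarrow>\<^sub>E A) \<and>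
        f ` (J \<rightarrow>\<^sub>E B) = L \<and> communication_complex B J I f \<subseteq> K)"

definition Mon :: "nat \<Rightarrow> (nat \<Rightarrow> nat) set" where
  "Mon n = {x \<in> {..<n} \<rightarrow>\<^sub>E {0, 1}. mono_on {..<n} x \<or> antimono_on {..<n} x}"

text \<open>
  The upper bound is the representative of \<open>b\<close> modulo \<open>n\<close> in the range from \<open>a\<close> to \<open>a + n - 1\<close>.
\<close>

definition cyclic_interval :: "nat \<Rightarrow> int \<Rightarrow> int \<Rightarrow> nat set" where
  "cyclic_interval n a b =
     {nat (c mod int n) | c. a \<le> c \<and> c \<le> a + (b - a) mod int n}"

lemma determinesD:
  assumes "determines B J f i W" "x \<in> J \<rightarrow>\<^sub>E B" "y \<in> J \<rightarrow>\<^sub>E B" "\<forall>j\<in>W. x j = y j"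
  shows "f x i = f y i"
  by (rule mp[OF bspec[OF bspec[OF conjunct2[OF assms(1)[unfolded determines_def]]]]])
     (use assms in simp_all)

lemma determines_subset: "determines B J f i W \<Longrightarrow> W \<subseteq> J"
  unfolding determines_def by (rule conjunct1)

lemma determines_Int:
  assumes "determines B J f i V" "determines B J f i W"
  shows "determines B J f i (V \<inter> W)"
  unfolding determines_def
proof (intro conjI ballI impI)
  show "V \<inter> W \<subseteq> J" using determines_subset[OF assms(1)] by blast
next
  fix x y assume x: "x \<in> J \<rightarrow>\<^sub>E B" and y: "y \<in> J \<rightarrow>\<^sub>E B" and xy: "\<forall>j\<in>V \<inter> W. x j = y j"
  define z where "z = (\<lambda>j. if j \<in> V then x j else y j)"
  have VJ: "V \<subseteq> J" by (rule determines_subset[OF assms(1)])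
  have z: "z \<in> J \<rightarrow>\<^sub>E B" using x y VJ by (auto simp: z_def PiE_def extensional_def)
  have "\<forall>j\<in>V. x j = z j" by (simp add: z_def)
  then have "f x i = f z i" by (rule determinesD[OF assms(1) x z])
  moreover have "\<forall>j\<in>W. z j = y j" using xy by (auto simp: z_def)
  then have "f z i = f y i" by (rule determinesD[OF assms(2) z y])
  ultimately show "f x i = f y i" by simp
qed

lemma ex_least_determines:
  assumes "finite J"
  shows "\<exists>W. determines B J f i W \<and> (\<forall>V. determines B J f i V \<longrightarrow> W \<subseteq> V)"
proof -
  have "determines B J f i J"
    unfolding determines_def
  proof (intro conjI ballI impI subset_refl)
    fix x y assume xy: "x \<in> J \<rightarrow>\<^sub>E B" "y \<in> J \<rightarrow>\<^sub>E B" "\<forall>j\<in>J. x j = y j"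
    have "x = y" by (rule PiE_ext[OF xy(1,2)]) (simp add: xy(3))
    then show "f x i = f y i" by simp
  qed
  then obtain W where W: "determines B J f i W"
    and min: "\<And>V. determines B J f i V \<Longrightarrow> card W \<le> card V"
    using ex_has_least_nat[of "determines B J f i" J card] by blast
  have "W \<subseteq> V" if "determines B J f i V" for V
  proof -
    have "finite W" by (rule finite_subset[OF determines_subset[OF W] assms])
    moreover have "card W \<le> card (W \<inter> V)" by (rule min[OF determines_Int[OF W that]])
    ultimately have "W \<inter> V = W" by (intro card_seteq) auto
    then show ?thesis by blast
  qed
  with W show ?thesis by (intro exI[of _ W] conjI allI impI)
qed

lemma determines_input_window:
  assumes "finite J"
  shows "determines B J f i (input_window B J f i)"
    and "determines B J f i V \<Longrightarrow> input_window B J f i \<subseteq> V"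
proof -
  obtain W where W: "determines B J f i W" "\<And>V. determines B J f i V \<Longrightarrow> W \<subseteq> V"
    using ex_least_determines[OF assms, of B f i] by (elim exE conjE) simp
  then have "input_window B J f i = W" unfolding input_window_def by (rule Least_equality)
  with W show "determines B J f i (input_window B J f i)"
    and "determines B J f i V \<Longrightarrow> input_window B J f i \<subseteq> V" by simp_all
qed

lemma generatesI:
  fixes B :: "'b set" and J :: "'j set" and f :: "('j \<Rightarrow> 'b) \<Rightarrow> 'i \<Rightarrow> 'a"
  assumes fin: "finite B" "finite J"
    and f: "f \<in> (J \<rightarrow>\<^sub>E B) \<rightarrow> (I \<rightarrow>\<^sub>E A)"
    and L: "f ` (J \<rightarrow>\<^sub>E B) = L"
    and K: "communication_complex B J I f \<subseteq> K"
  shows "generates A I K L"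
proof -
  obtain g :: "'b \<Rightarrow> nat" where g: "inj_on g B"
    using fin(1) finite_imp_inj_to_nat_seg by blast
  obtain h :: "'j \<Rightarrow> nat" where h: "inj_on h J"
    using fin(2) finite_imp_inj_to_nat_seg by blast
  define down where "down = (\<lambda>y. restrict (\<lambda>j. inv_into B g (y (h j))) J)"
  define up where "up = (\<lambda>x. restrict (\<lambda>k. g (x (inv_into J h k))) (h ` J))"
  define F where "F = (\<lambda>y. f (down y))"
  let ?B = "g ` B" and ?J = "h ` J"
  have down: "down y \<in> J \<rightarrow>\<^sub>E B" if "y \<in> ?J \<rightarrow>\<^sub>E ?B" for y
  proof -
    have "y (h j) \<in> g ` B" if "j \<in> J" for j using that \<open>y \<in> ?J \<rightarrow>\<^sub>E ?B\<close> by (auto simp: PiE_iff)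
    then show ?thesis unfolding down_def by (auto intro: inv_into_into)
  qed
  have up: "up x \<in> ?J \<rightarrow>\<^sub>E ?B" if "x \<in> J \<rightarrow>\<^sub>E B" for x
    using that h by (auto simp: up_def PiE_iff)
  have du: "down (up x) = x" if "x \<in> J \<rightarrow>\<^sub>E B" for x
  proof (rule PiE_ext)
    show "down (up x) \<in> J \<rightarrow>\<^sub>E B" using down up that by blast
    show "x \<in> J \<rightarrow>\<^sub>E B" by fact
    show "down (up x) j = x j" if "j \<in> J" for j
      using that \<open>x \<in> J \<rightarrow>\<^sub>E B\<close> g h by (auto simp: down_def up_def PiE_iff)
  qed
  have img: "down ` (?J \<rightarrow>\<^sub>E ?B) = J \<rightarrow>\<^sub>E B"
  proof
    show "down ` (?J \<rightarrow>\<^sub>E ?B) \<subseteq> J \<rightarrow>\<^sub>E B" using down by blast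
    show "J \<rightarrow>\<^sub>E B \<subseteq> down ` (?J \<rightarrow>\<^sub>E ?B)"
    proof
      fix x assume x: "x \<in> J \<rightarrow>\<^sub>E B"
      show "x \<in> down ` (?J \<rightarrow>\<^sub>E ?B)" using du[OF x, symmetric] up[OF x] by (rule image_eqI)
    qed
  qed
  have det: "determines ?B ?J F i (h ` W) \<longleftrightarrow> determines B J f i W" if W: "W \<subseteq> J" for i W
  proof
    assume d: "determines ?B ?J F i (h ` W)"
    show "determines B J f i W" unfolding determines_def
    proof (intro conjI ballI impI W)
      fix x y assume x: "x \<in> J \<rightarrow>\<^sub>E B" and y: "y \<in> J \<rightarrow>\<^sub>E B" and xy: "\<forall>j\<in>W. x j = y j"
      have "\<forall>k\<in>h ` W. up x k = up y k" using xy W h by (auto simp: up_def subset_iff)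
      then have "F (up x) i = F (up y) i" by (rule determinesD[OF d up[OF x] up[OF y]])
      then show "f x i = f y i" by (simp add: F_def du x y)
    qed
  next
    assume d: "determines B J f i W"
    show "determines ?B ?J F i (h ` W)" unfolding determines_def
    proof (intro conjI ballI impI image_mono W)
      fix x y assume x: "x \<in> ?J \<rightarrow>\<^sub>E ?B" and y: "y \<in> ?J \<rightarrow>\<^sub>E ?B" and xy: "\<forall>k\<in>h ` W. x k = y k"
      have "\<forall>j\<in>W. down x j = down y j" using xy by (auto simp: down_def)
      then show "F x i = F y i"
        unfolding F_def by (rule determinesD[OF d down[OF x] down[OF y]])
    qed
  qed
  note w = determines_input_window[where B = B and f = f, OF fin(2)]
  have wJ: "input_window B J f i \<subseteq> J" for i by (rule determines_subset[OF w(1)])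
  have win: "input_window ?B ?J F i = h ` input_window B J f i" for i
    unfolding input_window_def[of ?B]
  proof (rule Least_equality)
    show "determines ?B ?J F i (h ` input_window B J f i)"
      by (rule iffD2[OF det[OF wJ] w(1)])
  next
    fix V assume V: "determines ?B ?J F i V"
    then have "V \<subseteq> h ` J" by (rule determines_subset)
    then obtain W where W: "W \<subseteq> J" "V = h ` W" by (rule subset_imageE)
    then have "input_window B J f i \<subseteq> W" using V det[OF W(1)] by (intro w(2)) simp
    then show "h ` input_window B J f i \<subseteq> V" using W(2) by (simp add: image_mono)
  qed
  have "communication_complex ?B ?J I F \<subseteq> communication_complex B J I f"
  proof
    fix S assume S: "S \<in> communication_complex ?B ?J I F"
    show "S \<in> communication_complex B J I f"
    proof (cases "S = {}")
      case False
      from S obtain k where SI: "S \<subseteq> I" and k: "\<forall>i\<in>S. k \<in> h ` input_window B J f i"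
        unfolding communication_complex_def by (auto simp: win)
      have "inv_into J h k \<in> input_window B J f i" if i: "i \<in> S" for i
      proof -
        obtain j where "k = h j" "j \<in> input_window B J f i"
          using bspec[OF k i] by (rule imageE)
        then show ?thesis using inv_into_f_f[OF h, of j] subsetD[OF wJ] by simp
      qed
      then show ?thesis using SI unfolding communication_complex_def by blast
    qed (simp add: communication_complex_def)
  qed
  moreover have "F ` (?J \<rightarrow>\<^sub>E ?B) = L"
    using L by (simp only: F_def image_image[of f down, symmetric] img)
  moreover have "F \<in> (?J \<rightarrow>\<^sub>E ?B) \<rightarrow> (I \<rightarrow>\<^sub>E A)" using f down by (auto simp: F_def)
  ultimately show ?thesis unfolding generates_def using fin K
    by (intro exI[of _ ?B] exI[of _ ?J] exI[of _ F]) auto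
qed

lemma card_cyclic_interval:
  assumes "n \<ge> 1"
  shows "card (cyclic_interval n a b) = 1 + nat ((b - a) mod int n)"
proof -
  let ?d = "(b - a) mod int n"
  have d: "0 \<le> ?d" "?d < int n" using assms by auto
  have "cyclic_interval n a b = (\<lambda>c. nat (c mod int n)) ` {a..a + ?d}"
    by (auto simp: cyclic_interval_def)
  moreover have "inj_on (\<lambda>c. nat (c mod int n)) {a..a + ?d}"
  proof (rule inj_onI)
    fix x y assume xy: "x \<in> {a..a + ?d}" "y \<in> {a..a + ?d}"
      and "nat (x mod int n) = nat (y mod int n)"
    then have "x mod int n = y mod int n" using assms by (simp add: nat_eq_iff)
    then have "int n dvd x - y" by (simp add: mod_eq_dvd_iff)
    moreover have "\<bar>x - y\<bar> < int n" using xy d unfolding atLeastAtMost_iff by linarith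
    ultimately show "x = y" using dvd_imp_le_int[of "x - y" "int n"] by linarith
  qed
  ultimately show ?thesis using d by (simp add: card_image nat_add_distrib)
qed

end

theory Submission
  imports Defs
begin

text \<open>
  Let \<open>k = \<lfloor>(3n+1)/4\<rfloor>\<close> and suppose that no interval of size \<open>k\<close> is a simplex. The monotone words
  are indexed by an integer \<open>l\<close> modulo \<open>2n\<close>: unrolled to an \<open>n\<close>-antiperiodic sequence of bits,
  the word of index \<open>l\<close> has bit \<open>\<lfloor>(l - i)/n\<rfloor> mod 2\<close> at \<open>i\<close>, so it jumps after \<open>l\<close>. For each input
  \<open>j\<close> the set \<open>C j\<close> of positions ignoring \<open>j\<close> meets every \<open>k\<close> consecutive positions.

  Since between two equal bits less than \<open>n\<close> apart all bits are equal, a bit of a configuration for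
  word \<open>l\<close> survives a change of inputs if every changed input is ignored on both sides of it.
  A suitable hybrid of configurations for the words \<open>l\<close> and \<open>l - k\<close> thereby inherits a bit from
  either parent, which confines its jump to a window of length \<open>n - k\<close>. Going from one hybrid to
  the next, with \<open>l\<close> lowered by \<open>k\<close>, moves the jump forward by one relative to this window, so after
  \<open>n - k\<close> steps it has left the window.
\<close>

section \<open>Bits that survive a change of inputs\<close>

lemma finite_minimizer:
  fixes g :: "'a \<Rightarrow> int"
  assumes "finite D" "D \<noteq> {}"
  obtains j where "j \<in> D" "\<And>j'. j' \<in> D \<Longrightarrow> g j \<le> g j'"
proof -
  have "Min (g ` D) \<in> g ` D" using assms by simp
  then obtain j where "j \<in> D" "g j = Min (g ` D)" by (metis imageE)
  with assms that show thesis by simp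
qed

text \<open>
  \<open>Bit x i\<close> says that the unrolled output of the configuration \<open>x\<close> is 0 at \<open>i\<close>; \<open>cfg l\<close> is a
  preimage of the word of index \<open>l\<close>.
\<close>

locale gapped_jumps =
  fixes B :: "'b set" and J :: "'j set" and n k :: int
    and Bit :: "('j \<Rightarrow> 'b) \<Rightarrow> int \<Rightarrow> bool"
    and C :: "'j \<Rightarrow> int set"
    and cfg :: "int \<Rightarrow> 'j \<Rightarrow> 'b"
  assumes finite_J: "finite J"
    and k_pos: "1 \<le> k" and k_le_n: "k \<le> n"
    and jump: "x \<in> J \<rightarrow>\<^sub>E B \<Longrightarrow> \<exists>l. \<forall>i. Bit x i \<longleftrightarrow> even ((l - i) div n)"
    and cfg_in: "cfg l \<in> J \<rightarrow>\<^sub>E B"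
    and Bit_cfg: "Bit (cfg l) i \<longleftrightarrow> even ((l - i) div n)"
    and indep: "x \<in> J \<rightarrow>\<^sub>E B \<Longrightarrow> y \<in> J \<rightarrow>\<^sub>E B \<Longrightarrow> (\<forall>j'\<in>J - {j}. x j' = y j')
                  \<Longrightarrow> i \<in> C j \<Longrightarrow> Bit x i \<longleftrightarrow> Bit y i"
    and period: "i + n \<in> C j \<longleftrightarrow> i \<in> C j"
    and gap: "j \<in> J \<Longrightarrow> \<exists>i\<in>C j. a < i \<and> i \<le> a + k"
begin

lemma period_minus: "i - n \<in> C j \<longleftrightarrow> i \<in> C j"
  using period[of "i - n" j] by simp

lemma Bit_antiperiodic:
  assumes "x \<in> J \<rightarrow>\<^sub>E B"
  shows "Bit x (i - n) \<longleftrightarrow> \<not> Bit x i"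
proof -
  obtain l where l: "\<And>i. Bit x i \<longleftrightarrow> even ((l - i) div n)" using jump[OF assms] by blast
  have "n \<noteq> 0" using k_pos k_le_n by simp
  moreover have "l - (i - n) = (l - i) + n" by simp
  ultimately have "(l - (i - n)) div n = (l - i) div n + 1" by (metis div_add_self2)
  then show ?thesis by (simp add: l)
qed

text \<open>The quotient \<open>(l - i) div n\<close> is antitone in \<open>i\<close> and drops by
  at most one over a distance below \<open>n\<close>, so two even values at the ends must be
  equal.\<close>

lemma Bit_between:
  assumes "x \<in> J \<rightarrow>\<^sub>E B" "Bit x p" "Bit x q" "p \<le> i" "i \<le> q" "q < p + n"
  shows "Bit x i"
proof -
  obtain l where l: "\<And>i. Bit x i \<longleftrightarrow> even ((l - i) div n)" using jump[OF assms(1)] by blast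
  have n: "0 < n" using k_pos k_le_n by simp
  have squeeze: "m = a" if "even a" "even b" "b \<le> m" "m \<le> a" "a \<le> b + 1" for a b m :: int
  proof -
    have "a \<noteq> b + 1" using that(1,2) by auto
    then show ?thesis using that by linarith
  qed
  have "(l - q + n) div n = (l - q) div n + 1" using n by simp
  moreover have "(l - p) div n \<le> (l - q + n) div n" using assms n by (intro zdiv_mono1) auto
  ultimately have "(l - p) div n \<le> (l - q) div n + 1" by simp
  moreover have "(l - i) div n \<le> (l - p) div n" using assms n by (intro zdiv_mono1) auto
  moreover have "(l - q) div n \<le> (l - i) div n" using assms n by (intro zdiv_mono1) auto
  moreover have "even ((l - p) div n)" "even ((l - q) div n)" using assms l by auto
  ultimately have "(l - i) div n = (l - p) div n" by (intro squeeze)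
  with \<open>even ((l - p) div n)\<close> show ?thesis by (simp add: l)
qed

text \<open>Undoing the change of the input with the largest \<open>u\<close> keeps the bit at that
  point, which lies between \<open>u\<close> and \<open>v\<close> of all other changed inputs, so
  induction applies. The same holds at the smallest \<open>v\<close>, and \<open>Bit_between\<close>
  covers \<open>i\<close>.\<close>

lemma anchor:
  assumes "D \<subseteq> J" "x \<in> J \<rightarrow>\<^sub>E B" "\<And>j. j \<in> J - D \<Longrightarrow> x j = cfg l j"
    and "\<And>j. j \<in> D \<Longrightarrow> u j \<in> C j \<and> v j \<in> C j \<and> l - n < u j \<and> v j \<le> l \<and> u j \<le> i \<and> i \<le> v j"
    and "l - n < i" "i \<le> l"
  shows "Bit x i"
  using finite_subset[OF assms(1) finite_J] assms
proof (induction D arbitrary: x i rule: finite_psubset_induct)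
  case (psubset D)
  note x = psubset.prems(2) and agree = psubset.prems(3) and uv = psubset.prems(4)
  show ?case
  proof (cases "D = {}")
    case True
    have "x = cfg l" by (rule PiE_ext[OF x cfg_in]) (use agree True in auto)
    moreover have "(l - i) div n = 0" using psubset.prems by (intro div_pos_pos_trivial) auto
    ultimately show ?thesis by (simp add: Bit_cfg)
  next
    case False
    obtain p where p: "p \<in> D" "\<And>j. j \<in> D \<Longrightarrow> u j \<le> u p"
      using finite_minimizer[OF psubset.hyps False, of "\<lambda>j. - u j"] by auto
    obtain q where q: "q \<in> D" "\<And>j. j \<in> D \<Longrightarrow> v q \<le> v j"
      using finite_minimizer[OF psubset.hyps False] by auto
    have *: "Bit x m" if "j \<in> D" "m \<in> C j" "l - n < m" "m \<le> l"
      "\<And>j'. j' \<in> D \<Longrightarrow> u j' \<le> m \<and> m \<le> v j'" for j m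
    proof -
      let ?x = "x(j := cfg l j)"
      have x': "?x \<in> J \<rightarrow>\<^sub>E B"
        using x cfg_in[of l] that(1) psubset.prems(1) by (auto simp: PiE_iff extensional_def)
      have "Bit ?x m"
      proof (rule psubset.IH[of "D - {j}"])
        show "D - {j} \<subset> D" using that(1) by blast
        show "D - {j} \<subseteq> J" using psubset.prems(1) by blast
        show "?x j' = cfg l j'" if "j' \<in> J - (D - {j})" for j' using that agree by auto
      qed (use x' that uv in auto)
      moreover have "Bit x m \<longleftrightarrow> Bit ?x m" by (rule indep[OF x x' _ that(2)]) simp
      ultimately show ?thesis by simp
    qed
    have "Bit x (u p)"
    proof (rule *[OF p(1)])
      show "u j \<le> u p \<and> u p \<le> v j" if "j \<in> D" for j
        using uv[OF that] uv[OF p(1)] p(2)[OF that] by auto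
    qed (use uv[OF p(1)] in auto)
    moreover have "Bit x (v q)"
    proof (rule *[OF q(1)])
      show "u j \<le> v q \<and> v q \<le> v j" if "j \<in> D" for j
        using uv[OF that] uv[OF q(1)] q(2)[OF that] by auto
    qed (use uv[OF q(1)] in auto)
    ultimately show ?thesis
      by (rule Bit_between[OF x]) (use uv[OF p(1)] uv[OF q(1)] in auto)
  qed
qed

section \<open>Wide inputs and hybrids\<close>

text \<open>The distance 2(n - k) below \<open>L\<close> balances \<open>wide_next\<close>: two
  failures of the first condition of \<open>wide\<close> cover \<open>k\<close> positions if the
  distance is at most 2(n - k), two failures of the second if it is at least 2k - n - 1. Both fit
  because 4k \<le> 3n + 1.\<close>

definition pivot where "pivot L = L - 2 * n + 2 * k"

text \<open>
  The wide inputs are those which \<open>anchor\<close> allows to be changed at the pivot in \<open>cfg L\<close>.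
\<close>

definition wide where
  "wide j L \<longleftrightarrow> (\<exists>i\<in>C j. L - n < i \<and> i \<le> pivot L) \<and> (\<exists>i\<in>C j. pivot L \<le> i \<and> i \<le> L)"

definition hybrid where "hybrid L = (\<lambda>j\<in>J. if wide j L then cfg (L - k) j else cfg L j)"

lemma hybrid_in: "hybrid L \<in> J \<rightarrow>\<^sub>E B"
  using cfg_in by (auto simp: hybrid_def PiE_iff)

lemma anchor_box:
  assumes "2 * n \<le> 3 * k" "x \<in> J \<rightarrow>\<^sub>E B" "\<And>j. j \<in> J \<Longrightarrow> \<not> wide j L \<Longrightarrow> x j = cfg L j"
  shows "Bit x (pivot L)"
proof -
  have "\<forall>j. \<exists>u v. wide j L \<longrightarrow> u \<in> C j \<and> v \<in> C j \<and> L - n < u \<and> v \<le> L \<and> u \<le> pivot L \<and> pivot L \<le> v"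
    unfolding wide_def by blast
  then obtain u v where "\<And>j. wide j L \<Longrightarrow>
      u j \<in> C j \<and> v j \<in> C j \<and> L - n < u j \<and> v j \<le> L \<and> u j \<le> pivot L \<and> pivot L \<le> v j"
    by metis
  \<comment> \<open>From 2n \<le> 3k follows n < 2k, so the pivot lies in the run of zeros of
    \<open>cfg L\<close> from \<open>L - n + 1\<close> to \<open>L\<close>.\<close>
  then show ?thesis
    by (intro anchor[of "{j\<in>J. wide j L}" x L u v]) (use assms k_pos k_le_n in \<open>auto simp: pivot_def\<close>)
qed

context
  assumes ratio: "2 * n \<le> 3 * k" "4 * k \<le> 3 * n + 1"
begin

lemma gapE:
  assumes "j \<in> J"
  obtains i where "i \<in> C j" "i - n \<in> C j" "i + n \<in> C j" "a < i" "i \<le> a + k"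
  using gap[OF assms, of a] period period_minus by blast

text \<open>
  In the next two proofs, a failure of each claimed condition puts two excluded ranges side by side
  modulo \<open>n\<close>, and these cover \<open>k\<close> consecutive positions.
\<close>

lemma wide_next:
  assumes j: "j \<in> J" and "\<not> wide j L"
  shows "wide j (L + k)"
proof (rule ccontr)
  assume "\<not> wide j (L + k)"
  then have b: "(\<forall>i\<in>C j. \<not> (L + k - n < i \<and> i \<le> L - 2 * n + 3 * k))
      \<or> (\<forall>i\<in>C j. \<not> (L - 2 * n + 3 * k \<le> i \<and> i \<le> L + k))"
    by (auto simp: wide_def pivot_def algebra_simps)
  have a: "(\<forall>i\<in>C j. \<not> (L - n < i \<and> i \<le> L - 2 * n + 2 * k))
      \<or> (\<forall>i\<in>C j. \<not> (L - 2 * n + 2 * k \<le> i \<and> i \<le> L))"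
    using assms(2) by (auto simp: wide_def pivot_def algebra_simps)
  from a b show False
  proof (elim disjE)
    assume h: "\<forall>i\<in>C j. \<not> (L - n < i \<and> i \<le> L - 2 * n + 2 * k)"
      "\<forall>i\<in>C j. \<not> (L + k - n < i \<and> i \<le> L - 2 * n + 3 * k)"
    obtain i where "i \<in> C j" "i - n \<in> C j" "i + n \<in> C j"
      "L + k - n < i" "i \<le> L + k - n + k" by (rule gapE[OF j])
    then show False using bspec[OF h(1), of "i - n"] bspec[OF h(2), of i] ratio k_pos k_le_n
      by linarith
  next
    assume h: "\<forall>i\<in>C j. \<not> (L - n < i \<and> i \<le> L - 2 * n + 2 * k)"
      "\<forall>i\<in>C j. \<not> (L - 2 * n + 3 * k \<le> i \<and> i \<le> L + k)"
    obtain i where "i \<in> C j" "i - n \<in> C j" "i + n \<in> C j"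
      "L < i" "i \<le> L + k" by (rule gapE[OF j])
    then show False using bspec[OF h(1), of "i - n"] bspec[OF h(2), of i] ratio k_pos k_le_n
      by linarith
  next
    assume h: "\<forall>i\<in>C j. \<not> (L - 2 * n + 2 * k \<le> i \<and> i \<le> L)"
      "\<forall>i\<in>C j. \<not> (L + k - n < i \<and> i \<le> L - 2 * n + 3 * k)"
    obtain i where "i \<in> C j" "i - n \<in> C j" "i + n \<in> C j"
      "L - 2 * n + 2 * k - 1 < i" "i \<le> L - 2 * n + 2 * k - 1 + k" by (rule gapE[OF j])
    then show False using bspec[OF h(1), of i] bspec[OF h(2), of i] ratio k_pos k_le_n
      by linarith
  next
    assume h: "\<forall>i\<in>C j. \<not> (L - 2 * n + 2 * k \<le> i \<and> i \<le> L)"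
      "\<forall>i\<in>C j. \<not> (L - 2 * n + 3 * k \<le> i \<and> i \<le> L + k)"
    obtain i where "i \<in> C j" "i - n \<in> C j" "i + n \<in> C j"
      "L - k < i" "i \<le> L - k + k" by (rule gapE[OF j])
    then show False using bspec[OF h(1), of i] bspec[OF h(2), of "i + n"] ratio k_pos k_le_n
      by linarith
  qed
qed

lemma narrow:
  assumes j: "j \<in> J" and "\<not> wide j L"
  shows "\<exists>i\<in>C j. L - k - n < i \<and> i \<le> L - 2 * n + k"
    and "\<exists>i\<in>C j. L - 2 * n + k \<le> i \<and> i \<le> L - k"
proof -
  have a: "(\<forall>i\<in>C j. \<not> (L - n < i \<and> i \<le> L - 2 * n + 2 * k))
      \<or> (\<forall>i\<in>C j. \<not> (L - 2 * n + 2 * k \<le> i \<and> i \<le> L))"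
    using assms(2) by (auto simp: wide_def pivot_def algebra_simps)
  show "\<exists>i\<in>C j. L - k - n < i \<and> i \<le> L - 2 * n + k"
  proof (rule ccontr)
    assume "\<not> ?thesis"
    then have h: "\<forall>i\<in>C j. \<not> (L - k - n < i \<and> i \<le> L - 2 * n + k)" by blast
    obtain i where i: "i \<in> C j" "i - n \<in> C j" "i + n \<in> C j"
      "L - n < i" "i \<le> L - n + k" by (rule gapE[OF j])
    obtain i' where i': "i' \<in> C j" "i' - n \<in> C j" "i' + n \<in> C j"
      "L - k < i'" "i' \<le> L - k + k" by (rule gapE[OF j])
    from a show False
    proof
      assume g: "\<forall>i\<in>C j. \<not> (L - n < i \<and> i \<le> L - 2 * n + 2 * k)"
      show False using bspec[OF g i(1)] bspec[OF h i(2)] i ratio k_pos k_le_n by linarith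
    next
      assume g: "\<forall>i\<in>C j. \<not> (L - 2 * n + 2 * k \<le> i \<and> i \<le> L)"
      show False using bspec[OF g i'(1)] bspec[OF h i'(2)] i' ratio k_pos k_le_n by linarith
    qed
  qed
  show "\<exists>i\<in>C j. L - 2 * n + k \<le> i \<and> i \<le> L - k"
  proof (rule ccontr)
    assume "\<not> ?thesis"
    then have h: "\<forall>i\<in>C j. \<not> (L - 2 * n + k \<le> i \<and> i \<le> L - k)" by blast
    obtain i where i: "i \<in> C j" "i - n \<in> C j" "i + n \<in> C j"
      "L - n + k - 1 < i" "i \<le> L - n + k - 1 + k" by (rule gapE[OF j])
    obtain i' where i': "i' \<in> C j" "i' - n \<in> C j" "i' + n \<in> C j"
      "L - 2 * n + 2 * k - 1 < i'" "i' \<le> L - 2 * n + 2 * k - 1 + k" by (rule gapE[OF j])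
    from a show False
    proof
      assume g: "\<forall>i\<in>C j. \<not> (L - n < i \<and> i \<le> L - 2 * n + 2 * k)"
      show False using bspec[OF g i(2)] bspec[OF h i(2)] i ratio k_pos k_le_n by linarith
    next
      assume g: "\<forall>i\<in>C j. \<not> (L - 2 * n + 2 * k \<le> i \<and> i \<le> L)"
      show False using bspec[OF g i'(1)] bspec[OF h i'(2)] i' ratio k_pos k_le_n by linarith
    qed
  qed
qed

text \<open>The position is \<open>pivot (L - k)\<close>, and \<open>narrow\<close> says that an
  input not wide at \<open>L\<close> is wide at \<open>L - k\<close>. Hence \<open>hybrid L\<close>
  also keeps a bit of its other parent \<open>cfg (L - k)\<close>.\<close>

lemma hybrid_anchor: "Bit (hybrid L) (L - 2 * n + k)"
proof -
  have "\<forall>j. \<exists>u v. j \<in> J \<and> \<not> wide j L \<longrightarrow> u \<in> C j \<and> v \<in> C j \<and> L - k - n < u \<and> v \<le> L - k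
      \<and> u \<le> L - 2 * n + k \<and> L - 2 * n + k \<le> v"
    using narrow by meson
  then obtain u v where "\<And>j. j \<in> J \<Longrightarrow> \<not> wide j L \<Longrightarrow> u j \<in> C j \<and> v j \<in> C j \<and> L - k - n < u j
      \<and> v j \<le> L - k \<and> u j \<le> L - 2 * n + k \<and> L - 2 * n + k \<le> v j"
    by metis
  then show ?thesis
    by (intro anchor[of "{j\<in>J. \<not> wide j L}" _ "L - k" u v])
      (use hybrid_in ratio k_pos k_le_n in \<open>auto simp: hybrid_def\<close>)
qed

text \<open>
  The left end of the run of equal bits is fixed at the pivot while the inputs of \<open>hybrid L\<close> replace
  those of \<open>hybrid (L + k)\<close> one by one; its right end retreats to the first position \<open>c j\<close> ignoring
  an input replaced so far.
\<close>

lemma hybrid_step: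
  assumes "Bit (hybrid (L + k)) q" "pivot L + k \<le> q" "q < pivot L + n"
  shows "Bit (hybrid L) (q - k + 1)"
proof -
  have "\<forall>j. \<exists>i. j \<in> J \<longrightarrow> i \<in> C j \<and> q - k < i \<and> i \<le> q"
    using gap[of _ "q - k"] by fastforce
  then obtain c where c: "\<And>j. j \<in> J \<Longrightarrow> c j \<in> C j \<and> q - k < c j \<and> c j \<le> q" by metis
  let ?x = "\<lambda>D j. if j \<in> D then hybrid L j else hybrid (L + k) j"
  have x: "?x D \<in> J \<rightarrow>\<^sub>E B" if "D \<subseteq> J" for D
    using that hybrid_in[of L] hybrid_in[of "L + k"] by (auto simp: PiE_iff extensional_def)
  \<comment> \<open>By \<open>wide_next\<close>, an input not wide at \<open>L\<close> is taken from
    \<open>cfg L\<close> by both hybrids, so every mixture of them is anchored at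
    \<open>pivot L\<close>.\<close>
  have left: "Bit (?x D) (pivot L)" if "D \<subseteq> J" for D
    by (rule anchor_box[OF ratio(1) x[OF that]]) (use wide_next in \<open>auto simp: hybrid_def\<close>)
  have "Bit (?x D) i" if "D \<subseteq> J" "q - k < i" "i \<le> q" "\<And>j. j \<in> D \<Longrightarrow> i \<le> c j" for D i
    using finite_subset[OF that(1) finite_J] that
  proof (induction D arbitrary: i rule: finite_psubset_induct)
    case (psubset D)
    show ?case
    proof (cases "D = {}")
      case True
      show ?thesis
        by (rule Bit_between[OF x left, of _ q]) (use True assms psubset.prems in auto)
    next
      case False
      obtain p where p: "p \<in> D" "\<And>j. j \<in> D \<Longrightarrow> c p \<le> c j"
        using finite_minimizer[OF psubset.hyps False] by auto
      have pJ: "p \<in> J" using p psubset.prems by blast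
      have "Bit (?x (D - {p})) (c p)"
        by (rule psubset.IH) (use p psubset.prems c[OF pJ] in auto)
      moreover have "Bit (?x D) (c p) \<longleftrightarrow> Bit (?x (D - {p})) (c p)"
        by (rule indep[where j = p, OF x x]) (use psubset.prems c[OF pJ] in auto)
      ultimately have right: "Bit (?x D) (c p)" by simp
      show ?thesis
        by (rule Bit_between[OF x left right])
          (use p psubset.prems c[OF pJ] assms in auto)
    qed
  qed
  \<comment> \<open>Every \<open>c j\<close> exceeds \<open>q - k\<close>, so the right end never
    retreats beyond \<open>q - k + 1\<close>.\<close>
  from this[of J "q - k + 1"] have "Bit (?x J) (q - k + 1)" using c k_pos by force
  moreover have "?x J = hybrid L" by (auto simp: fun_eq_iff hybrid_def)
  ultimately show ?thesis by simp
qed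

lemma contradiction: False
proof -
  have "Bit (hybrid (- (int m * k))) (pivot (- (int m * k)) + int m)" if "int m \<le> n - k" for m
    using that
  proof (induction m)
    case 0
    show ?case by (simp, rule anchor_box[OF ratio(1) hybrid_in]) (auto simp: hybrid_def)
  next
    case (Suc m)
    let ?L = "- (int (Suc m) * k)"
    have L: "?L + k = - (int m * k)" by (simp add: algebra_simps)
    have "Bit (hybrid (?L + k)) (pivot ?L + k + int m)"
      using Suc unfolding L by (simp add: pivot_def algebra_simps)
    from hybrid_step[OF this] show ?case using Suc.prems by (simp add: algebra_simps)
  qed
  from this[of "nat (n - k)"] obtain L where "Bit (hybrid L) (pivot L + (n - k))"
    using k_le_n by auto
  moreover have "pivot L + (n - k) = L - n + k" by (simp add: pivot_def)
  \<comment> \<open>This position is \<open>n\<close> above the zero given by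
    \<open>hybrid_anchor\<close>.\<close>
  moreover have "\<not> Bit (hybrid L) (L - n + k)"
    using hybrid_anchor[of L] Bit_antiperiodic[OF hybrid_in, of L "L - n + k"]
    by (simp add: algebra_simps)
  ultimately show False by simp
qed

end

text \<open>Position 0 ignores every input, so \<open>cfg n\<close> and \<open>cfg 0\<close> would
  agree there, but their words are complementary.\<close>

lemma contradiction_1:
  assumes "k = 1"
  shows False
proof -
  have n: "n \<noteq> 0" "1 \<le> n" using k_pos k_le_n by auto
  have "0 \<in> C j" if j: "j \<in> J" for j
  proof -
    obtain i where "i \<in> C j" "- 1 < i" "i \<le> - 1 + k" using gap[OF j, of "- 1"] by blast
    moreover from this have "i = 0" using assms by linarith
    ultimately show ?thesis by simp
  qed
  then have "Bit (cfg n) 0"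
    using n by (intro anchor[of J _ 0 "\<lambda>_. 0" "\<lambda>_. 0"]) (auto simp: cfg_in)
  then show False using n by (simp add: Bit_cfg)
qed

lemma bounds_contradiction:
  assumes "4 * k \<le> 3 * n + 1" "3 * n \<le> 4 * k + 2"
  shows False
proof (cases "k = 1")
  case False
  \<comment> \<open>Integrality matters: n \<le> 3 for k = 2 and n \<le> 4 for k = 3. Only n = 2, k
    = 1 escapes this inequality.\<close>
  then have "2 * n \<le> 3 * k" using assms k_pos by presburger
  then show False using contradiction assms by blast
qed (rule contradiction_1)

end

section \<open>Indexing the monotone words and applying the locale\<close>

text \<open>
  The word of index \<open>l = m - 1 + q n\<close> with \<open>1 \<le> m \<le> n\<close> consists of \<open>m\<close> letters \<open>q mod 2\<close> followed by
  \<open>n - m\<close> letters \<open>(q - 1) mod 2\<close>.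
\<close>

definition word :: "nat \<Rightarrow> int \<Rightarrow> nat \<Rightarrow> nat" where
  "word n l = (\<lambda>i\<in>{..<n}. nat ((l - int i) div int n mod 2))"

lemma word_nth:
  assumes "i < n" "1 \<le> m" "m \<le> n"
  shows "word n (int m - 1 + q * int n) i = nat ((if i < m then q else q - 1) mod 2)"
proof -
  have "(int m - 1 + q * int n - int i) div int n = (if i < m then q else q - 1)"
  proof (cases "i < m")
    case True
    then have "(int m - 1 - int i) div int n = 0"
      using assms by (intro div_pos_pos_trivial) auto
    moreover have "int m - 1 + q * int n - int i = int m - 1 - int i + q * int n" by simp
    ultimately show ?thesis using assms True by (simp only: div_mult_self1) auto
  next
    case False
    then have "(int m - 1 - int i + int n) div int n = 0"
      using assms by (intro div_pos_pos_trivial) auto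
    moreover have "int m - 1 + q * int n - int i = int m - 1 - int i + int n + (q - 1) * int n"
      by (simp add: algebra_simps)
    ultimately show ?thesis using assms False by (simp only: div_mult_self1) auto
  qed
  then show ?thesis using assms by (simp add: word_def)
qed

lemma Mon_eq_range_word:
  assumes "n \<ge> 1"
  shows "Mon n = range (word n)"
proof (intro equalityI subsetI)
  fix w assume "w \<in> Mon n"
  then have w: "w \<in> {..<n} \<rightarrow>\<^sub>E {0, 1}" and mono: "mono_on {..<n} w \<or> antimono_on {..<n} w"
    by (auto simp: Mon_def)
  have bit: "w i = 0 \<or> w i = 1" if "i < n" for i using w that by auto
  \<comment> \<open>The length of the first constant block; the disjunct \<open>i = n\<close> yields
    \<open>n\<close> for a constant word.\<close>
  define m where "m = (LEAST i. i = n \<or> w i \<noteq> w 0)"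
  have m: "m = n \<or> w m \<noteq> w 0" unfolding m_def by (rule LeastI[of _ n]) simp
  have least: "i \<noteq> n \<and> w i = w 0" if "i < m" for i
    using not_less_Least[of i "\<lambda>i. i = n \<or> w i \<noteq> w 0"] that by (auto simp: m_def)
  have bounds: "1 \<le> m" "m \<le> n"
    using m assms Least_le[of "\<lambda>i. i = n \<or> w i \<noteq> w 0" n] by (cases m; simp add: m_def)+
  have after: "w i \<noteq> w 0" if "m \<le> i" "i < n" for i
    using mono
  proof
    assume "mono_on {..<n} w"
    then have "w 0 \<le> w m" "w m \<le> w i" using that by (auto intro: mono_onD)
    then show ?thesis using m that by auto
  next
    assume "antimono_on {..<n} w"
    then have "w m \<le> w 0" "w i \<le> w m" using that by (auto simp: monotone_on_def)
    then show ?thesis using m that by auto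
  qed
  \<comment> \<open>The first block has letter \<open>q mod 2\<close>, hence the choice of
    \<open>w 0\<close> for \<open>q\<close>.\<close>
  have "w = word n (int m - 1 + int (w 0) * int n)"
  proof (rule extensionalityI[of _ "{..<n}"])
    show "w i = word n (int m - 1 + int (w 0) * int n) i" if "i \<in> {..<n}" for i
      using that bit[of i] bit[of 0] least[of i] after[of i] bounds
      by (cases "i < m") (auto simp: word_nth)
  qed (use w in \<open>auto simp: word_def PiE_def\<close>)
  then show "w \<in> range (word n)" by blast
next
  fix w assume "w \<in> range (word n)"
  then obtain l where l: "w = word n l" by blast
  define m where "m = nat (l mod int n) + 1"
  define q where "q = l div int n"
  have m: "1 \<le> m" "m \<le> n" using assms by (auto simp: m_def nat_less_iff Suc_le_eq)
  have "l = int m - 1 + q * int n" using assms by (simp add: m_def q_def)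
  then have nth: "w i = nat ((if i < m then q else q - 1) mod 2)" if "i < n" for i
    using word_nth[OF that m] l by simp
  have "mono_on {..<n} w \<or> antimono_on {..<n} w"
  proof (cases "even q")
    case True
    then have "q mod 2 = 0" by presburger
    then have "mono_on {..<n} w" by (intro mono_onI) (auto simp: nth)
    then show ?thesis ..
  next
    case False
    then have "(q - 1) mod 2 = 0" by presburger
    then have "antimono_on {..<n} w" by (auto simp: nth monotone_on_def)
    then show ?thesis ..
  qed
  moreover have "w \<in> {..<n} \<rightarrow>\<^sub>E {0, 1}" by (auto simp: l word_def)
  ultimately show "w \<in> Mon n" by (simp add: Mon_def)
qed

text \<open>Reducing \<open>i\<close> modulo \<open>n\<close> shifts the quotient by
  \<open>i div n\<close>; adding this number back gives the antiperiodic extension of the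
  word.\<close>

lemma word_parity:
  assumes "n \<ge> 1"
  shows "even (int (word n l (nat (i mod int n))) + i div int n) \<longleftrightarrow> even ((l - i) div int n)"
proof -
  let ?r = "i mod int n"
  have r: "0 \<le> ?r" "nat ?r < n" using assms by (auto simp: nat_less_iff)
  have "l - ?r = l - i + (i div int n) * int n" using div_mult_mod_eq[of i "int n"] by linarith
  then have "(l - ?r) div int n = (l - i) div int n + i div int n"
    using assms by (simp only: div_mult_self1)
  moreover have "int (word n l (nat ?r)) = (l - ?r) div int n mod 2"
    using r by (simp add: word_def)
  ultimately show ?thesis by auto
qed

text \<open>If \<open>k\<close> consecutive positions all had \<open>j\<close> in their windows,
  \<open>j\<close> would make them a simplex of the communication complex, hence of
  \<open>K\<close>.\<close>

lemma gap_of_missing_intervals: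
  assumes "n \<ge> 1" "1 \<le> k" "k \<le> n"
    and "communication_complex B J {..<n} f \<subseteq> K"
    and missing: "\<And>a b. card (cyclic_interval n a b) = k \<Longrightarrow> cyclic_interval n a b \<notin> K"
  shows "\<exists>i. j \<notin> input_window B J f (nat (i mod int n)) \<and> a < i \<and> i \<le> a + int k"
proof (rule ccontr)
  assume "\<not> ?thesis"
  then have all: "j \<in> input_window B J f (nat (i mod int n))" if "a < i" "i \<le> a + int k" for i
    using that by blast
  let ?S = "cyclic_interval n (a + 1) (a + int k)"
  have len: "(a + int k - (a + 1)) mod int n = int k - 1" using assms by simp
  have card: "card ?S = k" unfolding card_cyclic_interval[OF assms(1)] len using assms(2) by simp
  have "\<forall>i\<in>?S. j \<in> input_window B J f i"
    unfolding cyclic_interval_def len by (auto intro: all)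
  moreover have "?S \<subseteq> {..<n}" using assms(1) by (auto simp: cyclic_interval_def nat_less_iff)
  ultimately have "?S \<in> communication_complex B J {..<n} f"
    unfolding communication_complex_def by blast
  then show False using missing[OF card] assms(4) by blast
qed

theorem theorem7p4:
  fixes n :: nat and K :: "nat set set"
  assumes "n \<ge> 1"
    and "simplicial_complex {..<n} K"
    and "generates {0, 1} {..<n} K (Mon n)"
  shows "\<exists>a b :: int. cyclic_interval n a b \<in> K \<and>
           int (card (cyclic_interval n a b)) = \<lfloor>real (3 * n + 1) / 4\<rfloor>"
proof (rule ccontr)
  assume neg: "\<not> ?thesis"
  define k where "k = (3 * n + 1) div 4"
  have k: "1 \<le> k" "k \<le> n" "4 * k \<le> 3 * n + 1" "3 * n \<le> 4 * k + 2"
    using assms(1) unfolding k_def by linarith+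
  have "\<lfloor>real (3 * n + 1) / 4\<rfloor> = int k"
    using floor_divide_of_nat_eq[of "3 * n + 1" 4, where 'a = real] by (simp add: k_def)
  then have missing: "cyclic_interval n a b \<notin> K" if "card (cyclic_interval n a b) = k" for a b
    using neg that by auto
  obtain B J :: "nat set" and f where fin: "finite J"
    and img: "f ` (J \<rightarrow>\<^sub>E B) = Mon n" and sub: "communication_complex B J {..<n} f \<subseteq> K"
    using assms(3) unfolding generates_def by blast
  have outputs: "f ` (J \<rightarrow>\<^sub>E B) = range (word n)" using img Mon_eq_range_word[OF assms(1)] by simp
  then have "\<forall>l. \<exists>x. x \<in> J \<rightarrow>\<^sub>E B \<and> f x = word n l" by (metis imageE rangeI)
  then obtain cfg where cfg: "\<And>l. cfg l \<in> J \<rightarrow>\<^sub>E B" "\<And>l. f (cfg l) = word n l" by metis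
  interpret gapped_jumps B J "int n" "int k"
    "\<lambda>x i. even (int (f x (nat (i mod int n))) + i div int n)"
    "\<lambda>j. {i. j \<notin> input_window B J f (nat (i mod int n))}" cfg
  proof
    show "\<exists>l. \<forall>i. even (int (f x (nat (i mod int n))) + i div int n) \<longleftrightarrow> even ((l - i) div int n)"
      if "x \<in> J \<rightarrow>\<^sub>E B" for x
    proof -
      have "f x \<in> range (word n)" unfolding outputs[symmetric] using that by (rule imageI)
      then obtain l where "f x = word n l" by blast
      then show ?thesis using word_parity[OF assms(1)] by auto
    qed
    show "even (int (f x (nat (i mod int n))) + i div int n)
        \<longleftrightarrow> even (int (f y (nat (i mod int n))) + i div int n)"
      if "x \<in> J \<rightarrow>\<^sub>E B" "y \<in> J \<rightarrow>\<^sub>E B" "\<forall>j'\<in>J - {j}. x j' = y j'"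
        "i \<in> {i. j \<notin> input_window B J f (nat (i mod int n))}" for x y j i
    proof -
      note win = determines_input_window(1)[OF fin, of B f "nat (i mod int n)"]
      have "f x (nat (i mod int n)) = f y (nat (i mod int n))"
        by (rule determinesD[OF win that(1,2)]) (use determines_subset[OF win] that(3,4) in blast)
      then show ?thesis by simp
    qed
    show "\<exists>i\<in>{i. j \<notin> input_window B J f (nat (i mod int n))}. a < i \<and> i \<le> a + int k" for j a
      using gap_of_missing_intervals[OF assms(1) k(1,2) sub missing, of j a] by blast
  qed (use k fin cfg word_parity[OF assms(1)] in auto)
  show False by (rule bounds_contradiction) (use k in linarith)+
qed

end
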